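(* Let $F$ be a real vector space, let $\lambda_1,\ldots,\lambda_m \in F^*$ be linear functionals, and let $\Lambda: F \to \mathbb{R}^m$, $\Lambda(f) = (\lambda_1(f),\ldots,\lambda_m(f))$. Suppose that the model set $\mathcal{K} \subseteq F$ is convex and contains the origin and that the functional $\gamma: F \to \mathbb{R}$ can be expressed as $$\gamma(f) = \sup_{a \in A} \inf_{i \in I_a} \gamma_i(f) = \inf_{b \in B} \sup_{j \in J_b} \gamma_j(f), \qquad f \in F,$$ where the $\gamma_i \in F^*$ are linear functionals (a single family, with all the $I_a$, $a \in A$, and $J_b$, $b \in B$, being finite subsets of its index set). Consider the convex optimization program $$\underset{\substack{e \in \mathbb{R},\ e',e'' \in \mathbb{R}^{A \times B}\\ c^{(a_\star,b_\star)} \in \mathbb{R}^m\\ \sigma^{(a_\star,b_\star)} \in \mathcal{S}^{I_{a_\star}}\\ \tau^{(a_\star,b_\star)} \in \mathcal{S}^{J_{b_\star}}}}{\rm minimize} \quad e$$ subject to $$\begin{cases} e'_{a_\star,b_\star} + e''_{a_\star,b_\star} \le 2e, & a_\star \in A,\ b_\star \in B,\\ \big\| \sum_{i \in I_{a_\star}} \sigma^{(a_\star,b_\star)}_i \gamma_i - \sum_{k=1}^m c^{(a_\star,b_\star)}_k \lambda_k \big\|_{\mathcal{K}} \le e'_{a_\star,b_\star}, & a_\star \in A,\ b_\star \in B,\\ \big\| - \sum_{j \in J_{b_\star}} \tau^{(a_\star,b_\star)}_j \gamma_j + \sum_{k=1}^m c^{(a_\star,b_\star)}_k \lambda_k \big\|_{\mathcal{K}}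 \le e''_{a_\star,b_\star}, & a_\star \in A,\ b_\star \in B, \end{cases}$$ where there is one variable $c^{(a_\star,b_\star)}$, $\sigma^{(a_\star,b_\star)}$, $\tau^{(a_\star,b_\star)}$ for each $(a_\star,b_\star) \in A \times B$. Let hats denote a solution (minimizer) of this program, and set $\widehat{c}^{(a_\star,b_\star)}_0 := \widehat{e} - \widehat{e}''_{a_\star,b_\star}$ for all $a_\star \in A$, $b_\star \in B$. Then the sup-inf-affine functional $\delta^{\rm opti}: \mathbb{R}^m \to \mathbb{R}$ defined by $$\delta^{\rm opti}(y) = \sup_{a \in A} \inf_{b \in B} \bigg( \widehat{c}^{(a,b)}_0 + \sum_{k=1}^m \widehat{c}^{(a,b)}_k y_k \bigg), \qquad y \in \mathbb{R}^m,$$ is an optimal functional for the estimation of $\gamma$.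
   Context: $F^*$ denotes the space of linear functionals on $F$. For $\eta \in F^*$, the notation $\|\eta\|_{\mathcal{K}} := \sup_{f \in \mathcal{K}} \eta(f)$ stands for the support function of $\mathcal{K}$ evaluated at $\eta$ (it may take the value $+\infty$ and is not necessarily a norm). The standard simplex associated with a finite index set $I$ is $\mathcal{S}^I := \{ \sigma \in \mathbb{R}^I : \sigma_i \ge 0 \mbox{ for all } i \in I \mbox{ and } \sum_{i \in I} \sigma_i = 1\}$. The worst-case error over $\mathcal{K}$ of an estimation functional $\delta: \mathbb{R}^m \to \mathbb{R}$ for $\gamma$ is $e(\delta) := \sup_{f \in \mathcal{K}} |\gamma(f) - \delta(\Lambda(f))| \in [0,+\infty]$. For every $\delta: \mathbb{R}^m \to \mathbb{R}$ one has the lower bound $e(\delta) \ge e_\flat$, where $$e_\flat := \sup_{\substack{f',f'' \in \mathcal{K}\\ \Lambda(f')=\Lambda(f'')}} \frac{|\gamma(f')-\gamma(f'')|}{2} \in [0,+\infty].$$ An estimation functional $\delta$ is called (genuinely) optimal if $e(\delta) \le e_\flat$, so that $e(\delta) = e_\flat$ is the minimal value of the error over all functionals from $\mathbb{R}^m$ to $\mathbb{R}$. *)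

theory Defs
  imports "HOL-Analysis.Analysis"
begin

definition observation :: "('m::finite \<Rightarrow> 'f \<Rightarrow> real) \<Rightarrow> 'f \<Rightarrow> real ^ 'm" where
  "observation lam f = (\<chi> k. lam k f)"

definition support_fun :: "'f set \<Rightarrow> ('f \<Rightarrow> real) \<Rightarrow> ereal" where
  "support_fun K \<eta> = (SUP f\<in>K. ereal (\<eta> f))"

text \<open>A point of the simplex over \<open>I\<close> is a function on the whole type; its values outside \<open>I\<close>
  are unconstrained and never used.\<close>
definition std_simplex :: "'i set \<Rightarrow> ('i \<Rightarrow> real) set" where
  "std_simplex I = {\<sigma>. (\<forall>i\<in>I. 0 \<le> \<sigma> i) \<and> (\<Sum>i\<in>I. \<sigma> i) = 1}"

definition worst_case_error ::
    "'f set \<Rightarrow> ('f \<Rightarrow> real) \<Rightarrow> ('m::finite \<Rightarrow> 'f \<Rightarrow> real) \<Rightarrow> (real ^ 'm \<Rightarrow> real) \<Rightarrow> ereal" where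
  "worst_case_error K \<gamma> lam \<delta> = (SUP f\<in>K. ereal \<bar>\<gamma> f - \<delta> (observation lam f)\<bar>)"

definition error_lower_bound ::
    "'f set \<Rightarrow> ('f \<Rightarrow> real) \<Rightarrow> ('m::finite \<Rightarrow> 'f \<Rightarrow> real) \<Rightarrow> ereal" where
  "error_lower_bound K \<gamma> lam =
    (SUP (f', f'') \<in> {(f', f''). f' \<in> K \<and> f'' \<in> K \<and> observation lam f' = observation lam f''}.
      ereal (\<bar>\<gamma> f' - \<gamma> f''\<bar> / 2))"

definition optimal_functional ::
    "'f set \<Rightarrow> ('f \<Rightarrow> real) \<Rightarrow> ('m::finite \<Rightarrow> 'f \<Rightarrow> real) \<Rightarrow> (real ^ 'm \<Rightarrow> real) \<Rightarrow> bool" where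
  "optimal_functional K \<gamma> lam \<delta> \<longleftrightarrow>
    worst_case_error K \<gamma> lam \<delta> \<le> error_lower_bound K \<gamma> lam"

text \<open>The program variables indexed by \<open>A \<times> B\<close> are curried functions on the whole types; values
  outside \<open>A\<close> and \<open>B\<close> are unconstrained and never used.\<close>
definition program_feasible ::
    "'f set \<Rightarrow> ('m::finite \<Rightarrow> 'f \<Rightarrow> real) \<Rightarrow> ('i \<Rightarrow> 'f \<Rightarrow> real)
      \<Rightarrow> 'a set \<Rightarrow> 'b set \<Rightarrow> ('a \<Rightarrow> 'i set) \<Rightarrow> ('b \<Rightarrow> 'i set)
      \<Rightarrow> real \<Rightarrow> ('a \<Rightarrow> 'b \<Rightarrow> real) \<Rightarrow> ('a \<Rightarrow> 'b \<Rightarrow> real) \<Rightarrow> ('a \<Rightarrow> 'b \<Rightarrow> real ^ 'm)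
      \<Rightarrow> ('a \<Rightarrow> 'b \<Rightarrow> 'i \<Rightarrow> real) \<Rightarrow> ('a \<Rightarrow> 'b \<Rightarrow> 'i \<Rightarrow> real) \<Rightarrow> bool" where
  "program_feasible K lam gam A B I J e e' e'' c \<sigma> \<tau> \<longleftrightarrow>
    (\<forall>a\<in>A. \<forall>b\<in>B.
      \<sigma> a b \<in> std_simplex (I a) \<and> \<tau> a b \<in> std_simplex (J b) \<and>
      e' a b + e'' a b \<le> 2 * e \<and>
      support_fun K (\<lambda>f. (\<Sum>i\<in>I a. \<sigma> a b i * gam i f) - (\<Sum>k\<in>UNIV. c a b $ k * lam k f))
        \<le> ereal (e' a b) \<and>
      support_fun K (\<lambda>f. - (\<Sum>j\<in>J b. \<tau> a b j * gam j f) + (\<Sum>k\<in>UNIV. c a b $ k * lam k f))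
        \<le> ereal (e'' a b))"

definition program_minimizer ::
    "'f set \<Rightarrow> ('m::finite \<Rightarrow> 'f \<Rightarrow> real) \<Rightarrow> ('i \<Rightarrow> 'f \<Rightarrow> real)
      \<Rightarrow> 'a set \<Rightarrow> 'b set \<Rightarrow> ('a \<Rightarrow> 'i set) \<Rightarrow> ('b \<Rightarrow> 'i set)
      \<Rightarrow> real \<Rightarrow> ('a \<Rightarrow> 'b \<Rightarrow> real) \<Rightarrow> ('a \<Rightarrow> 'b \<Rightarrow> real) \<Rightarrow> ('a \<Rightarrow> 'b \<Rightarrow> real ^ 'm)
      \<Rightarrow> ('a \<Rightarrow> 'b \<Rightarrow> 'i \<Rightarrow> real) \<Rightarrow> ('a \<Rightarrow> 'b \<Rightarrow> 'i \<Rightarrow> real) \<Rightarrow> bool" where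
  "program_minimizer K lam gam A B I J e e' e'' c \<sigma> \<tau> \<longleftrightarrow>
    program_feasible K lam gam A B I J e e' e'' c \<sigma> \<tau> \<and>
    (\<forall>x x' x'' d \<rho> \<theta>. program_feasible K lam gam A B I J x x' x'' d \<rho> \<theta> \<longrightarrow> e \<le> x)"

text \<open>Extended-real valued: for infinite \<open>A\<close> or \<open>B\<close> the supremum or the infima can be infinite,
  where the conditionally complete operations on \<^typ>\<open>real\<close> would return an unspecified value.\<close>
definition sup_inf_affine ::
    "'a set \<Rightarrow> 'b set \<Rightarrow> ('a \<Rightarrow> 'b \<Rightarrow> real) \<Rightarrow> ('a \<Rightarrow> 'b \<Rightarrow> real ^ 'm) \<Rightarrow> real ^ 'm::finite \<Rightarrow> ereal" where
  "sup_inf_affine A B c0 c y =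
    (SUP a\<in>A. INF b\<in>B. ereal (c0 a b + (\<Sum>k\<in>UNIV. c a b $ k * y $ k)))"

end

theory Submission
  imports Defs
begin

text \<open>
  Write \<open>\<Lambda> f\<close> for the observation of \<open>f\<close> and \<open>E\<close> for the lower bound on the error. Two
  inequalities have to be combined: every feasible point of the program with value \<open>e\<close> yields a
  functional with error at most \<open>e\<close>, and, when \<open>E\<close> is finite, some feasible point has value
  \<open>E\<close>, so that the minimal value is at most \<open>E\<close>.

  The first inequality (\<open>feasible_sup_inf_affine_bounds\<close>) is a pointwise computation. At
  \<open>f \<in> K\<close> the two support function constraints say that the affine function with indices
  \<open>(a, b)\<close>, evaluated at \<open>\<Lambda> f\<close>, lies between \<open>\<Sum>i. \<sigma> i * gam i f - e\<close> and
  \<open>\<Sum>j. \<tau> j * gam j f + e\<close>, hence between \<open>(INF i\<in>I a. gam i f) - e\<close> and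
  \<open>(SUP j\<in>J b. gam j f) + e\<close>. Now take the infimum over \<open>b\<close> and then the supremum over
  \<open>a\<close>: the lower bound does not depend on \<open>b\<close> and the sup-inf formula for \<open>\<gamma>\<close> gives
  \<open>\<gamma> f - e\<close>; the upper bound does not depend on \<open>a\<close> and the inf-sup formula gives
  \<open>\<gamma> f + e\<close>.

  The second inequality (\<open>error_lower_bound_feasible\<close>) is a strong duality statement, and it can
  be treated separately for each \<open>(a, b)\<close>. If \<open>f, g \<in> K\<close> have the same observation, then
  \<open>\<gamma> f - \<gamma> g \<le> 2 * E\<close>; some \<open>i \<in> I a\<close> has \<open>gam i f \<le> \<gamma> f\<close> and some \<open>j \<in> J b\<close>
  has \<open>\<gamma> g \<le> gam j g\<close>, so \<open>gam i f - gam j g \<le> 2 * E\<close> for these indices. On the convex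
  set of all such pairs \<open>(f, g)\<close> a theorem of alternatives (\<open>concave_finite_alternative\<close>)
  replaces the choice of \<open>(i, j)\<close>, which depends on the pair, by fixed weights; their marginals
  are \<open>\<sigma>\<close> and \<open>\<tau>\<close>. The restriction \<open>\<Lambda> f = \<Lambda> g\<close> is then removed by Lagrange multipliers
  \<open>c\<close> (\<open>concave_linear_multipliers\<close>). Multipliers exist without any loss because exchanging
  \<open>f\<close> and \<open>g\<close> negates \<open>\<Lambda> f - \<Lambda> g\<close>, which makes 0 a relative interior point of the
  attained values. What results is an upper bound \<open>2 * E\<close> for a sum of a function of \<open>f\<close> and a
  function of \<open>g\<close>, with \<open>f\<close> and \<open>g\<close> ranging independently over \<open>K\<close>; hence the two
  suprema are finite and add up to at most \<open>2 * E\<close>, as feasibility requires.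
\<close>

section \<open>Multipliers for concave functions\<close>

lemma concave_on_nonneg_combination:
  assumes "finite I" "convex S"
    and "\<And>i. i \<in> I \<Longrightarrow> 0 \<le> w i" "\<And>i. i \<in> I \<Longrightarrow> concave_on S (g i)"
  shows "concave_on S (\<lambda>x. \<Sum>i\<in>I. w i * g i x)"
  using assms
proof (induction I)
  case empty
  then show ?case by (simp add: concave_on_const)
next
  case (insert k I)
  have "concave_on S (\<lambda>x. w k * g k x + (\<Sum>i\<in>I. w i * g i x))"
    using insert by (intro concave_on_add concave_on_cmul) auto
  then show ?case using insert by simp
qed

lemma linear_imp_concave_on:
  fixes l :: "'a::real_vector \<Rightarrow> real"
  assumes "linear l" "convex S"
  shows "concave_on S l"
  using assms by (auto simp: concave_on_iff linear_add linear_cmul)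

text \<open>The hypothesis says that the region of the plane below the points \<open>(g x, h x)\<close> misses the open
  positive quadrant. Both sets are convex, and the normal of a line separating them has nonnegative
  entries; normalising it to sum 1 gives \<open>t\<close>.\<close>
lemma concave_pair_alternative:
  fixes g h :: "'a::real_vector \<Rightarrow> real"
  assumes g: "concave_on S g" and h: "concave_on S h"
    and le: "\<And>x. x \<in> S \<Longrightarrow> g x \<le> 0 \<or> h x \<le> 0"
  shows "\<exists>t. 0 \<le> t \<and> t \<le> 1 \<and> (\<forall>x\<in>S. t * g x + (1 - t) * h x \<le> 0)"
proof (cases "S = {}")
  case True
  then show ?thesis by (auto intro: exI[of _ 0])
next
  case False
  then obtain x0 where x0: "x0 \<in> S" by blast
  define X where "X = {p :: real \<times> real. \<exists>x\<in>S. fst p \<le> g x \<and> snd p \<le> h x}"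
  define T where "T = {p :: real \<times> real. 0 < fst p \<and> 0 < snd p}"
  have "convex X"
    unfolding convex_def
  proof (intro ballI allI impI)
    fix p q :: "real \<times> real" and u v :: real
    assume p: "p \<in> X" and q: "q \<in> X" and uv: "0 \<le> u" "0 \<le> v" "u + v = 1"
    obtain x where x: "x \<in> S" "fst p \<le> g x" "snd p \<le> h x" using p by (auto simp: X_def)
    obtain y where y: "y \<in> S" "fst q \<le> g y" "snd q \<le> h y" using q by (auto simp: X_def)
    have S: "u *\<^sub>R x + v *\<^sub>R y \<in> S"
      using concave_on_imp_convex[OF g] x y uv by (auto simp: convex_def)
    have "u * g x + v * g y \<le> g (u *\<^sub>R x + v *\<^sub>R y)" "u * h x + v * h y \<le> h (u *\<^sub>R x + v *\<^sub>R y)"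
      using g h x y uv by (auto simp: concave_on_iff)
    moreover have "u * fst p + v * fst q \<le> u * g x + v * g y" "u * snd p + v * snd q \<le> u * h x + v * h y"
      using x y uv by (auto intro!: add_mono mult_left_mono)
    ultimately show "u *\<^sub>R p + v *\<^sub>R q \<in> X"
      unfolding X_def using S by (auto intro!: bexI[of _ "u *\<^sub>R x + v *\<^sub>R y"])
  qed
  moreover have "convex T"
    unfolding convex_def
  proof (intro ballI allI impI)
    fix p q :: "real \<times> real" and u v :: real
    assume "p \<in> T" "q \<in> T" and uv: "0 \<le> u" "0 \<le> v" "u + v = 1"
    then have pos: "0 < fst p" "0 < snd p" "0 < fst q" "0 < snd q" by (auto simp: T_def)
    consider "u > 0" | "v > 0" using uv by linarith
    then show "u *\<^sub>R p + v *\<^sub>R q \<in> T"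
      by cases (use pos uv in \<open>auto simp: T_def intro: add_pos_nonneg add_nonneg_pos\<close>)
  qed
  moreover have "X \<noteq> {}" proof -
    have "(g x0, h x0) \<in> X" using x0 by (auto simp: X_def)
    then show ?thesis by blast
  qed
  moreover have "T \<noteq> {}" by (auto simp: T_def intro!: exI[of _ "1::real"])
  moreover have "X \<inter> T = {}"
    using le by (force simp: X_def T_def)
  ultimately obtain n b where n: "n \<noteq> 0" "\<forall>p\<in>X. inner n p \<le> b" "\<forall>p\<in>T. inner n p \<ge> b"
    using separating_hyperplane_sets by metis
  define \<alpha> \<beta> where "\<alpha> = fst n" and "\<beta> = snd n"
  have X: "\<alpha> * u + \<beta> * v \<le> b" if "x \<in> S" "u \<le> g x" "v \<le> h x" for x u v
    using n(2) that by (force simp: X_def inner_prod_def \<alpha>_def \<beta>_def)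
  have T: "b \<le> \<alpha> * u + \<beta> * v" if "0 < u" "0 < v" for u v
    using n(3) that by (force simp: T_def inner_prod_def \<alpha>_def \<beta>_def)
  \<comment> \<open>\<open>X\<close> is closed under decreasing either coordinate, so a normal bounded above on it
    has nonnegative entries.\<close>
  have "\<alpha> \<ge> 0"
  proof (rule ccontr)
    assume "\<not> \<alpha> \<ge> 0"
    then have neg: "\<alpha> < 0" by simp
    define s where "s = (\<bar>b - \<alpha> * g x0 - \<beta> * h x0\<bar> + 1) / (- \<alpha>)"
    have "s \<ge> 0" using neg by (auto simp: s_def divide_nonneg_neg)
    moreover have "\<alpha> * s = - (\<bar>b - \<alpha> * g x0 - \<beta> * h x0\<bar> + 1)" using neg by (simp add: s_def)
    ultimately show False
      using X[OF x0, of "g x0 - s" "h x0"] by (auto simp: algebra_simps)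
  qed
  have "\<beta> \<ge> 0"
  proof (rule ccontr)
    assume "\<not> \<beta> \<ge> 0"
    then have neg: "\<beta> < 0" by simp
    define s where "s = (\<bar>b - \<alpha> * g x0 - \<beta> * h x0\<bar> + 1) / (- \<beta>)"
    have "s \<ge> 0" using neg by (auto simp: s_def divide_nonneg_neg)
    moreover have "\<beta> * s = - (\<bar>b - \<alpha> * g x0 - \<beta> * h x0\<bar> + 1)" using neg by (simp add: s_def)
    ultimately show False
      using X[OF x0, of "g x0" "h x0 - s"] by (auto simp: algebra_simps)
  qed
  have pos: "\<alpha> + \<beta> > 0"
  proof -
    have "\<alpha> \<noteq> 0 \<or> \<beta> \<noteq> 0" using n(1) by (auto simp: \<alpha>_def \<beta>_def prod_eq_iff)
    then show ?thesis using \<open>\<alpha> \<ge> 0\<close> \<open>\<beta> \<ge> 0\<close> by linarith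
  qed
  \<comment> \<open>The origin lies in the closure of \<open>T\<close>.\<close>
  have "b \<le> 0"
  proof (rule ccontr)
    assume "\<not> b \<le> 0"
    then have b: "b > 0" by simp
    define r where "r = \<alpha> + \<beta>"
    define s where "s = b / (2 * r)"
    have r: "r > 0" using pos by (simp add: r_def)
    then have "s > 0" using b by (simp add: s_def)
    moreover have "\<alpha> * s + \<beta> * s = r * s" by (simp add: distrib_right r_def)
    then have "\<alpha> * s + \<beta> * s = b / 2" using r by (simp add: s_def)
    ultimately show False using T[of s s] b by simp
  qed
  define t where "t = \<alpha> / (\<alpha> + \<beta>)"
  have t1: "1 - t = \<beta> / (\<alpha> + \<beta>)" using pos by (simp add: t_def field_simps)
  have "t * g x + (1 - t) * h x \<le> 0" if "x \<in> S" for x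
  proof -
    have "t * g x + (1 - t) * h x = (\<alpha> * g x + \<beta> * h x) / (\<alpha> + \<beta>)"
      unfolding t1 by (simp add: t_def add_divide_distrib)
    also have "\<dots> \<le> 0"
      using X[OF that order_refl order_refl] \<open>b \<le> 0\<close> pos by (simp add: divide_le_0_iff)
    finally show ?thesis .
  qed
  moreover have "0 \<le> t" "t \<le> 1"
    using pos \<open>\<alpha> \<ge> 0\<close> \<open>\<beta> \<ge> 0\<close> by (auto simp: t_def)
  ultimately show ?thesis by blast
qed

text \<open>Induction on \<open>I\<close>: where the new function \<open>g k\<close> is positive, which is a convex set, one of the
  old functions is nonpositive, and the induction hypothesis there supplies one weighted combination
  \<open>h\<close> of them. Everywhere else \<open>g k \<le> 0\<close>, so \<open>g k\<close> and \<open>h\<close> fulfil the hypothesis for two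
  functions.\<close>
lemma concave_finite_alternative:
  fixes g :: "'i \<Rightarrow> 'a::real_vector \<Rightarrow> real"
  assumes "finite I" "I \<noteq> {}" "convex S"
    and "\<And>i. i \<in> I \<Longrightarrow> concave_on S (g i)"
    and "\<And>x. x \<in> S \<Longrightarrow> \<exists>i\<in>I. g i x \<le> 0"
  shows "\<exists>w\<in>std_simplex I. \<forall>x\<in>S. (\<Sum>i\<in>I. w i * g i x) \<le> 0"
  using assms
proof (induction I arbitrary: S rule: finite_ne_induct)
  case (singleton k)
  then show ?case
    by (intro bexI[of _ "\<lambda>_. 1"]) (auto simp: std_simplex_def)
next
  case (insert k I)
  define S' where "S' = {x \<in> S. g k x > 0}"
  have gk: "concave_on S (g k)" using insert.prems by blast
  have "convex S'"
    unfolding convex_def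
  proof (intro ballI allI impI)
    fix x y :: 'a and u v :: real
    assume xy: "x \<in> S'" "y \<in> S'" and uv: "0 \<le> u" "0 \<le> v" "u + v = 1"
    have "u * g k x + v * g k y \<le> g k (u *\<^sub>R x + v *\<^sub>R y)"
      using gk xy uv by (auto simp: concave_on_iff S'_def)
    moreover have "0 < u * g k x + v * g k y"
    proof -
      consider "u > 0" | "v > 0" using uv by linarith
      then show ?thesis
        by cases (use xy uv in \<open>auto simp: S'_def intro: add_pos_nonneg add_nonneg_pos\<close>)
    qed
    moreover have "u *\<^sub>R x + v *\<^sub>R y \<in> S"
      using insert.prems(1) xy uv by (auto simp: convex_def S'_def)
    ultimately show "u *\<^sub>R x + v *\<^sub>R y \<in> S'" by (auto simp: S'_def)
  qed
  moreover have "concave_on S' (g i)" if "i \<in> I" for i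
  proof -
    have "concave_on S (g i)" using insert.prems that by blast
    then show ?thesis using \<open>convex S'\<close> by (auto simp: concave_on_iff S'_def)
  qed
  moreover have "\<exists>i\<in>I. g i x \<le> 0" if "x \<in> S'" for x
    using insert.prems(3)[of x] that by (auto simp: S'_def)
  ultimately obtain w where w: "w \<in> std_simplex I" "\<forall>x\<in>S'. (\<Sum>i\<in>I. w i * g i x) \<le> 0"
    using insert.IH[of S'] by blast
  define h where "h x = (\<Sum>i\<in>I. w i * g i x)" for x
  have "concave_on S h"
    unfolding h_def using insert w by (intro concave_on_nonneg_combination) (auto simp: std_simplex_def)
  moreover have "g k x \<le> 0 \<or> h x \<le> 0" if "x \<in> S" for x
    using w that by (force simp: S'_def h_def)
  ultimately obtain t where t: "0 \<le> t" "t \<le> 1" "\<forall>x\<in>S. t * g k x + (1 - t) * h x \<le> 0"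
    using concave_pair_alternative[OF gk, of h] by blast
  define w' where "w' i = (if i = k then t else (1 - t) * w i)" for i
  have off: "w' i = (1 - t) * w i" if "i \<in> I" for i
    using insert that by (auto simp: w'_def)
  have comb: "(\<Sum>i\<in>insert k I. w' i * v i) = t * v k + (1 - t) * (\<Sum>i\<in>I. w i * v i)" for v :: "'i \<Rightarrow> real"
  proof -
    have "(\<Sum>i\<in>I. w' i * v i) = (1 - t) * (\<Sum>i\<in>I. w i * v i)"
      unfolding sum_distrib_left by (intro sum.cong) (auto simp: off)
    then show ?thesis using insert by (simp add: w'_def)
  qed
  have "(\<Sum>i\<in>insert k I. w' i) = 1"
    using comb[of "\<lambda>_. 1"] w by (simp add: std_simplex_def)
  then have "w' \<in> std_simplex (insert k I)"
    using t w off by (auto simp: std_simplex_def w'_def)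
  moreover have "\<forall>x\<in>S. (\<Sum>i\<in>insert k I. w' i * g i x) \<le> 0"
    using t unfolding comb h_def by auto
  ultimately show ?case by blast
qed

text \<open>A multiplier must separate the slopes \<open>g p / l p\<close> at points with \<open>l p > 0\<close> from the slopes
  at points with \<open>l q < 0\<close>. The former never exceed the latter, since otherwise \<open>g\<close> would be
  positive where the segment from \<open>p\<close> to \<open>q\<close> meets \<open>l = 0\<close>. Unless \<open>l\<close>
  vanishes on \<open>S\<close>, the symmetry provides points of both kinds, so the supremum of the former slopes
  is a real number and serves as the multiplier.\<close>
lemma concave_linear_multiplier:
  fixes g l :: "'a::real_vector \<Rightarrow> real"
  assumes g: "concave_on S g" and l: "linear l"
    and sym: "\<And>x. x \<in> S \<Longrightarrow> \<exists>y\<in>S. l y = - l x"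
    and le: "\<And>x. x \<in> S \<Longrightarrow> l x = 0 \<Longrightarrow> g x \<le> 0"
  shows "\<exists>c. \<forall>x\<in>S. g x - c * l x \<le> 0"
proof (cases "\<forall>x\<in>S. l x = 0")
  case True
  then show ?thesis using le by auto
next
  case False
  define P where "P = {x \<in> S. l x > 0}"
  define N where "N = {x \<in> S. l x < 0}"
  have ne: "P \<noteq> {}" "N \<noteq> {}"
  proof -
    obtain x where x: "x \<in> S" "l x \<noteq> 0" using False by blast
    then obtain y where "y \<in> S" "l y = - l x" using sym by blast
    then have "(x \<in> P \<and> y \<in> N) \<or> (y \<in> P \<and> x \<in> N)" using x by (auto simp: P_def N_def)
    then show "P \<noteq> {}" "N \<noteq> {}" by blast+
  qed
  have slopes: "g p / l p \<le> g q / l q" if "p \<in> P" "q \<in> N" for p q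
  proof -
    have p: "p \<in> S" "l p > 0" and q: "q \<in> S" "l q < 0" using that by (auto simp: P_def N_def)
    \<comment> \<open>The point where the segment from \<open>p\<close> to \<open>q\<close> crosses the hyperplane \<open>l = 0\<close>.\<close>
    define u where "u = - l q / (l p - l q)"
    define v where "v = l p / (l p - l q)"
    define z where "z = u *\<^sub>R p + v *\<^sub>R q"
    have uv: "0 \<le> u" "0 \<le> v" "u + v = 1"
      using p q by (simp_all add: u_def v_def divide_nonpos_pos flip: diff_divide_distrib)
    have "z \<in> S"
      using concave_on_imp_convex[OF g] p q uv by (auto simp: convex_def z_def)
    moreover have "l z = u * l p + v * l q"
      by (simp add: z_def linear_add[OF l] linear_cmul[OF l])
    then have "l z = 0" using p q by (simp add: u_def v_def field_simps)
    ultimately have "g z \<le> 0" using le by blast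
    moreover have "u * g p + v * g q \<le> g z"
      using g p q uv by (auto simp: concave_on_iff z_def)
    ultimately have "u * g p + v * g q \<le> 0" by simp
    then have "(l p - l q) * (u * g p + v * g q) \<le> 0"
      using p q by (intro mult_nonneg_nonpos) auto
    moreover have "(l p - l q) * u = - l q" "(l p - l q) * v = l p"
      using p q by (simp_all add: u_def v_def)
    then have "(l p - l q) * (u * g p + v * g q) = - l q * g p + l p * g q"
      by (simp only: distrib_left mult.assoc[symmetric])
    ultimately have "- l q * g p + l p * g q \<le> 0" by simp
    then show ?thesis using p q by (simp add: field_simps)
  qed
  define c where "c = (SUP p\<in>P. g p / l p)"
  obtain q0 where q0: "q0 \<in> N" using ne by blast
  have bdd: "bdd_above ((\<lambda>p. g p / l p) ` P)"
    using slopes[OF _ q0] by (rule bdd_aboveI2)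
  have "g x - c * l x \<le> 0" if "x \<in> S" for x
  proof -
    consider "x \<in> P" | "x \<in> N" | "l x = 0"
      using \<open>x \<in> S\<close> less_linear[of "l x" 0] by (auto simp: P_def N_def)
    then show ?thesis
    proof cases
      case 1
      then have "g x / l x \<le> c" unfolding c_def using bdd by (rule cSUP_upper)
      then show ?thesis using 1 by (simp add: P_def field_simps)
    next
      case 2
      have "c \<le> g x / l x" unfolding c_def using ne slopes[OF _ 2] by (intro cSUP_least) auto
      then show ?thesis using 2 by (simp add: N_def field_simps)
    next
      case 3
      then show ?thesis using le that by simp
    qed
  qed
  then show ?thesis by blast
qed

text \<open>The constraints are removed one at a time. A multiplier for \<open>l k\<close> is found on the set \<open>Q\<close>
  where the other constraints hold, and the induction hypothesis is applied to \<open>g\<close> minus the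
  corresponding multiple of \<open>l k\<close>. This needs the symmetry to hold for all functionals at once:
  only then does \<open>Q\<close> inherit it.\<close>
lemma concave_linear_multipliers:
  fixes g :: "'a::real_vector \<Rightarrow> real" and l :: "'k \<Rightarrow> 'a \<Rightarrow> real"
  assumes "finite M" "concave_on S g"
    and l: "\<And>k. linear (l k)"
    and sym: "\<And>x. x \<in> S \<Longrightarrow> \<exists>y\<in>S. \<forall>k. l k y = - l k x"
    and "\<And>x. x \<in> S \<Longrightarrow> \<forall>k\<in>M. l k x = 0 \<Longrightarrow> g x \<le> 0"
  shows "\<exists>c. \<forall>x\<in>S. g x - (\<Sum>k\<in>M. c k * l k x) \<le> 0"
  using assms(1,2,5)
proof (induction M arbitrary: g)
  case empty
  then show ?case by simp
next
  case (insert k M)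
  define Q where "Q = {x \<in> S. \<forall>j\<in>M. l j x = 0}"
  have cS: "convex S" using insert.prems concave_on_imp_convex by blast
  have "convex Q"
    using cS by (auto simp: Q_def convex_def linear_add[OF l] linear_cmul[OF l])
  then have "concave_on Q g"
    using insert.prems(1) by (auto simp: concave_on_iff Q_def)
  moreover have "\<exists>y\<in>Q. l k y = - l k x" if "x \<in> Q" for x
  proof -
    have "x \<in> S" using that by (simp add: Q_def)
    then obtain y where "y \<in> S" "\<forall>k. l k y = - l k x" using sym by blast
    then show ?thesis using that by (auto simp: Q_def)
  qed
  moreover have "g x \<le> 0" if "x \<in> Q" "l k x = 0" for x
    using insert.prems(2)[of x] that by (auto simp: Q_def)
  ultimately obtain d where d: "\<forall>x\<in>Q. g x - d * l k x \<le> 0"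
    using concave_linear_multiplier[of Q g "l k"] l by blast
  define h where "h x = g x + (- d) * l k x" for x
  have lin: "linear (\<lambda>x. (- d) * l k x)"
    using l linear_compose_scale_right[of "l k" "- d"] by simp
  have "concave_on S h"
    unfolding h_def by (rule concave_on_add[OF insert.prems(1) linear_imp_concave_on[OF lin cS]])
  moreover have "h x \<le> 0" if "x \<in> S" "\<forall>k\<in>M. l k x = 0" for x
    using d that by (auto simp: Q_def h_def)
  ultimately obtain c where c: "\<forall>x\<in>S. h x - (\<Sum>k\<in>M. c k * l k x) \<le> 0"
    using insert.IH by blast
  have "(\<Sum>j\<in>M. (c(k := d)) j * l j x) = (\<Sum>j\<in>M. c j * l j x)" for x
    using insert by (intro sum.cong) auto
  then have "\<forall>x\<in>S. g x - (\<Sum>j\<in>insert k M. (c(k := d)) j * l j x) \<le> 0"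
    using c insert by (simp add: h_def algebra_simps)
  then show ?case by blast
qed

section \<open>Duality for one pair of indices\<close>

lemma simplex_ge_some:
  assumes "finite I" "\<sigma> \<in> std_simplex I"
  shows "\<exists>i\<in>I. v i \<le> (\<Sum>i\<in>I. \<sigma> i * v i)"
proof (rule ccontr)
  assume "\<not> ?thesis"
  then have lt: "\<And>i. i \<in> I \<Longrightarrow> (\<Sum>i\<in>I. \<sigma> i * v i) \<le> v i" 
    and lt': "\<And>i. i \<in> I \<Longrightarrow> (\<Sum>i\<in>I. \<sigma> i * v i) < v i" by force+
  define s where "s = (\<Sum>i\<in>I. \<sigma> i * v i)"
  obtain k where k: "k \<in> I" "\<sigma> k > 0"
  proof -
    have "\<exists>k\<in>I. \<sigma> k \<noteq> 0"
    proof (rule ccontr)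
      assume "\<not> ?thesis"
      then have "sum \<sigma> I = 0" by (intro sum.neutral) blast
      then show False using assms by (simp add: std_simplex_def)
    qed
    then show ?thesis using assms that by (force simp: std_simplex_def)
  qed
  have "(\<Sum>i\<in>I. \<sigma> i * s) < (\<Sum>i\<in>I. \<sigma> i * v i)"
    using assms k lt lt'
    by (intro sum_strict_mono_ex1) (auto simp: std_simplex_def s_def intro!: mult_left_mono bexI[of _ k])
  then show False
    using assms by (simp add: s_def std_simplex_def flip: sum_distrib_right)
qed

lemma product_simplex_marginals:
  fixes u v :: "_ \<Rightarrow> real"
  assumes w: "w \<in> std_simplex (I \<times> J)"
  defines "\<sigma> \<equiv> \<lambda>i. \<Sum>j\<in>J. w (i, j)" and "\<tau> \<equiv> \<lambda>j. \<Sum>i\<in>I. w (i, j)"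
  shows "\<sigma> \<in> std_simplex I" "\<tau> \<in> std_simplex J"
    and "(\<Sum>(i, j)\<in>I \<times> J. w (i, j) * (u i - v j)) = (\<Sum>i\<in>I. \<sigma> i * u i) - (\<Sum>j\<in>J. \<tau> j * v j)"
proof -
  have tot: "(\<Sum>i\<in>I. \<Sum>j\<in>J. w (i, j)) = 1"
    using w by (simp add: std_simplex_def sum.cartesian_product)
  show "\<sigma> \<in> std_simplex I" 
    using w tot by (auto simp: std_simplex_def \<sigma>_def intro!: sum_nonneg)
  have "(\<Sum>j\<in>J. \<Sum>i\<in>I. w (i, j)) = 1" using tot by (subst sum.swap)
  then show "\<tau> \<in> std_simplex J" 
    using w by (auto simp: std_simplex_def \<tau>_def intro!: sum_nonneg)
  have "(\<Sum>(i, j)\<in>I \<times> J. w (i, j) * (u i - v j))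
      = (\<Sum>i\<in>I. \<Sum>j\<in>J. w (i, j) * u i) - (\<Sum>i\<in>I. \<Sum>j\<in>J. w (i, j) * v j)"
    by (simp add: sum.cartesian_product[symmetric] right_diff_distrib sum_subtractf)
  also have "(\<Sum>i\<in>I. \<Sum>j\<in>J. w (i, j) * v j) = (\<Sum>j\<in>J. \<Sum>i\<in>I. w (i, j) * v j)"
    by (rule sum.swap)
  finally show "(\<Sum>(i, j)\<in>I \<times> J. w (i, j) * (u i - v j)) = (\<Sum>i\<in>I. \<sigma> i * u i) - (\<Sum>j\<in>J. \<tau> j * v j)"
    by (simp add: \<sigma>_def \<tau>_def sum_distrib_right)
qed

text \<open>The simplex weights have to be found before the multipliers, on the pairs with equal observations:
  the weighted combination is then a single concave function on \<open>K \<times> K\<close>, to which the multipliers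
  for the constraints \<open>lam k f - lam k g = 0\<close> apply.\<close>
lemma simplex_multiplier_duality:
  fixes lam :: "'m::finite \<Rightarrow> 'f::real_vector \<Rightarrow> real" and gam :: "'i \<Rightarrow> 'f \<Rightarrow> real"
  assumes lam: "\<And>k. linear (lam k)" and K: "convex K"
    and gam: "\<And>i. linear (gam i)"
    and fin: "finite I" "finite J" and ne: "I \<noteq> {}" "J \<noteq> {}"
    and le: "\<And>f g. f \<in> K \<Longrightarrow> g \<in> K \<Longrightarrow> observation lam f = observation lam g
        \<Longrightarrow> \<exists>i\<in>I. \<exists>j\<in>J. gam i f - gam j g \<le> d"
  obtains \<sigma> \<tau> and c :: "real ^ 'm"
  where "\<sigma> \<in> std_simplex I" "\<tau> \<in> std_simplex J"
    and "\<And>f g. f \<in> K \<Longrightarrow> g \<in> K \<Longrightarrow>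
      ((\<Sum>i\<in>I. \<sigma> i * gam i f) - (\<Sum>k\<in>UNIV. c $ k * lam k f))
      + (- (\<Sum>j\<in>J. \<tau> j * gam j g) + (\<Sum>k\<in>UNIV. c $ k * lam k g)) \<le> d"
proof -
  define l where "l k p = lam k (fst p) - lam k (snd p)" for k and p :: "'f \<times> 'f"
  define \<phi> where "\<phi> q p = gam (fst q) (fst p) - gam (snd q) (snd p) - d" for q and p :: "'f \<times> 'f"
  define Q where "Q = {p \<in> K \<times> K. \<forall>k. l k p = 0}"
  have lin_l: "linear (l k)" for k
    by (rule linearI) (auto simp: l_def linear_add[OF lam] linear_cmul[OF lam] algebra_simps)
  have KK: "convex (K \<times> K)" using K by (intro convex_Times)
  have cQ: "convex Q"
    using KK unfolding Q_def convex_def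
    by (auto simp: linear_add[OF lin_l] linear_cmul[OF lin_l] simp del: mem_Times_iff)
  have conc: "concave_on (K \<times> K) (\<phi> q)" for q
    unfolding concave_on_iff
  proof (intro conjI KK ballI allI impI)
    fix x y :: "'f \<times> 'f" and u v :: real assume "0 \<le> u" "0 \<le> v" "u + v = 1"
    then have "u * d + v * d = d" by (simp flip: distrib_right)
    then show "u * \<phi> q x + v * \<phi> q y \<le> \<phi> q (u *\<^sub>R x + v *\<^sub>R y)"
      by (simp add: \<phi>_def linear_add[OF gam] linear_cmul[OF gam] algebra_simps)
  qed
  have concQ: "concave_on Q (\<phi> q)" for q
    using conc[of q] cQ by (auto simp: concave_on_iff Q_def)
  have "\<exists>q\<in>I \<times> J. \<phi> q p \<le> 0" if "p \<in> Q" for p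
  proof -
    have "\<exists>i\<in>I. \<exists>j\<in>J. gam i (fst p) - gam j (snd p) \<le> d"
      using that by (intro le) (auto simp: Q_def l_def observation_def)
    then show ?thesis by (force simp: \<phi>_def)
  qed
  then obtain w where w: "w \<in> std_simplex (I \<times> J)" "\<forall>p\<in>Q. (\<Sum>q\<in>I \<times> J. w q * \<phi> q p) \<le> 0"
    using concave_finite_alternative[of "I \<times> J" Q \<phi>] fin ne cQ concQ by auto
  define g where "g p = (\<Sum>q\<in>I \<times> J. w q * \<phi> q p)" for p
  define \<sigma> where "\<sigma> i = (\<Sum>j\<in>J. w (i, j))" for i
  define \<tau> where "\<tau> j = (\<Sum>i\<in>I. w (i, j))" for j
  have "concave_on (K \<times> K) g"
    unfolding g_def using fin KK w conc
    by (intro concave_on_nonneg_combination) (auto simp: std_simplex_def)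
  moreover have "\<exists>y\<in>K \<times> K. \<forall>k. l k y = - l k x" if "x \<in> K \<times> K" for x
    using that by (intro bexI[of _ "(snd x, fst x)"]) (auto simp: l_def)
  moreover have "g x \<le> 0" if "x \<in> K \<times> K" "\<forall>k\<in>UNIV. l k x = 0" for x
    using w(2) that unfolding Q_def g_def by blast
  ultimately obtain c where c: "\<forall>x\<in>K \<times> K. g x - (\<Sum>k\<in>UNIV. c k * l k x) \<le> 0"
    using concave_linear_multipliers[of UNIV "K \<times> K" g l] lin_l by auto
  have g: "g (x, y) = (\<Sum>i\<in>I. \<sigma> i * gam i x) - (\<Sum>j\<in>J. \<tau> j * gam j y) - d" for x y
  proof -
    have "g (x, y) = (\<Sum>(i, j)\<in>I \<times> J. w (i, j) * (gam i x - gam j y)) - (\<Sum>q\<in>I \<times> J. w q) * d"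
      by (simp add: g_def \<phi>_def case_prod_beta algebra_simps sum_subtractf sum.distrib sum_distrib_left)
    also have "(\<Sum>q\<in>I \<times> J. w q) = 1" using w by (simp add: std_simplex_def)
    finally show ?thesis
      using product_simplex_marginals(3)[OF w(1), of "\<lambda>i. gam i x" "\<lambda>j. gam j y"]
      by (simp add: \<sigma>_def \<tau>_def)
  qed
  show ?thesis
  proof
    show "\<sigma> \<in> std_simplex I" "\<tau> \<in> std_simplex J"
      using product_simplex_marginals(1,2)[OF w(1)] by (simp_all add: \<sigma>_def[abs_def] \<tau>_def[abs_def])
    fix x y assume "x \<in> K" "y \<in> K"
    then have "g (x, y) - (\<Sum>k\<in>UNIV. c k * l k (x, y)) \<le> 0" using c by auto
    then show "((\<Sum>i\<in>I. \<sigma> i * gam i x) - (\<Sum>k\<in>UNIV. (\<chi> k. c k) $ k * lam k x))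
      + (- (\<Sum>j\<in>J. \<tau> j * gam j y) + (\<Sum>k\<in>UNIV. (\<chi> k. c k) $ k * lam k y)) \<le> d"
      by (simp add: g l_def right_diff_distrib sum_subtractf)
  qed
qed

lemma split_sum_bound:
  fixes p q :: "'f \<Rightarrow> real"
  assumes "K \<noteq> {}" and le: "\<And>f g. f \<in> K \<Longrightarrow> g \<in> K \<Longrightarrow> p f + q g \<le> d"
  obtains s where "support_fun K p \<le> ereal s" "support_fun K q \<le> ereal (d - s)"
proof
  obtain g0 where g0: "g0 \<in> K" using assms by blast
  have bdd: "bdd_above (p ` K)"
    using le[OF _ g0] by (auto intro!: bdd_aboveI[of _ "d - q g0"] simp: algebra_simps)
  show "support_fun K p \<le> ereal (SUP f\<in>K. p f)"
    unfolding support_fun_def using bdd by (auto intro!: SUP_least cSUP_upper)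
  have "(SUP f\<in>K. p f) \<le> d - q g" if "g \<in> K" for g
    using assms le[OF _ that] by (intro cSUP_least) (auto simp: algebra_simps)
  then show "support_fun K q \<le> ereal (d - (SUP f\<in>K. p f))"
    unfolding support_fun_def by (force intro!: SUP_least simp: algebra_simps)
qed

section \<open>Values of max-min expressions\<close>

lemma SUP_INF_finite_real:
  fixes v :: "'a \<Rightarrow> 'b \<Rightarrow> real"
  assumes "finite A" "finite B" "A \<noteq> {}" "B \<noteq> {}"
  shows "\<bar>SUP a\<in>A. INF b\<in>B. ereal (v a b)\<bar> \<noteq> \<infinity>"
proof -
  have inner: "\<exists>r. (INF b\<in>B. ereal (v a b)) = ereal r" for a
  proof -
    have "(INF b\<in>B. ereal (v a b)) \<in> (\<lambda>b. ereal (v a b)) ` B"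
      using assms Min_in[of "(\<lambda>b. ereal (v a b)) ` B"] by (simp add: Min_Inf)
    then show ?thesis by auto
  qed
  have "(SUP a\<in>A. INF b\<in>B. ereal (v a b)) \<in> (\<lambda>a. INF b\<in>B. ereal (v a b)) ` A"
    using assms Max_in[of "(\<lambda>a. INF b\<in>B. ereal (v a b)) ` A"] by (simp add: Max_Sup)
  then obtain a where "(SUP a\<in>A. INF b\<in>B. ereal (v a b)) = (INF b\<in>B. ereal (v a b))" by blast
  then show ?thesis using inner[of a] by auto
qed

lemma SUP_INF_real_nonempty:
  assumes "ereal x = (SUP a\<in>A. INF i\<in>I a. ereal (v i))"
  shows "A \<noteq> {}" "\<And>a. a \<in> A \<Longrightarrow> I a \<noteq> {}"
proof -
  show "A \<noteq> {}" using assms by (auto simp: bot_ereal_def)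
  show "I a \<noteq> {}" if "a \<in> A" for a
  proof
    assume "I a = {}"
    then have "\<infinity> \<le> (SUP a\<in>A. INF i\<in>I a. ereal (v i))"
      using that by (intro SUP_upper2[of a]) (auto simp: top_ereal_def)
    then show False using assms[symmetric] by simp
  qed
qed

lemma INF_SUP_real_nonempty:
  assumes "ereal x = (INF b\<in>B. SUP j\<in>J b. ereal (v j))"
  shows "B \<noteq> {}" "\<And>b. b \<in> B \<Longrightarrow> J b \<noteq> {}"
proof -
  show "B \<noteq> {}" using assms by (auto simp: top_ereal_def)
  show "J b \<noteq> {}" if "b \<in> B" for b
  proof
    assume "J b = {}"
    then have "(INF b\<in>B. SUP j\<in>J b. ereal (v j)) \<le> -\<infinity>"
      using that by (intro INF_lower2[of b]) (auto simp: bot_ereal_def)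
    then show False using assms[symmetric] by simp
  qed
qed

lemma SUP_INF_ge_some:
  assumes "ereal x = (SUP a\<in>A. INF i\<in>I a. ereal (v i))" "a \<in> A" "finite (I a)"
  shows "\<exists>i\<in>I a. v i \<le> x"
proof -
  have "I a \<noteq> {}" using SUP_INF_real_nonempty(2)[OF assms(1,2)] .
  then have "(INF i\<in>I a. ereal (v i)) \<in> (\<lambda>i. ereal (v i)) ` I a"
    using assms Min_in[of "(\<lambda>i. ereal (v i)) ` I a"] by (simp add: Min_Inf)
  moreover have "(INF i\<in>I a. ereal (v i)) \<le> ereal x"
    unfolding assms(1) using assms(2) by (rule SUP_upper)
  ultimately show ?thesis by auto
qed

lemma INF_SUP_le_some:
  assumes "ereal x = (INF b\<in>B. SUP j\<in>J b. ereal (v j))" "b \<in> B" "finite (J b)"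
  shows "\<exists>j\<in>J b. x \<le> v j"
proof -
  have "J b \<noteq> {}" using INF_SUP_real_nonempty(2)[OF assms(1,2)] .
  then have "(SUP j\<in>J b. ereal (v j)) \<in> (\<lambda>j. ereal (v j)) ` J b"
    using assms Max_in[of "(\<lambda>j. ereal (v j)) ` J b"] by (simp add: Max_Sup)
  moreover have "ereal x \<le> (SUP j\<in>J b. ereal (v j))"
    unfolding assms(1) using assms(2) by (rule INF_lower)
  ultimately show ?thesis by auto
qed

section \<open>The program computes the optimal error\<close>

text \<open>The choice \<open>c0 a b = e - e'' a b\<close> turns the second support function constraint into the upper
  bound; since \<open>e' a b - e \<le> e - e'' a b\<close>, the same choice turns the first one into the lower
  bound.\<close>
lemma feasible_sup_inf_affine_bounds:
  fixes lam :: "'m::finite \<Rightarrow> 'f::real_vector \<Rightarrow> real"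
  assumes fin: "\<And>a. a \<in> A \<Longrightarrow> finite (I a)" "\<And>b. b \<in> B \<Longrightarrow> finite (J b)"
    and \<gamma>1: "ereal \<gamma>f = (SUP a\<in>A. INF i\<in>I a. ereal (gam i f))"
    and \<gamma>2: "ereal \<gamma>f = (INF b\<in>B. SUP j\<in>J b. ereal (gam j f))"
    and feas: "program_feasible K lam gam A B I J e e' e'' c \<sigma> \<tau>"
    and c0: "\<And>a b. a \<in> A \<Longrightarrow> b \<in> B \<Longrightarrow> c0 a b = e - e'' a b"
    and f: "f \<in> K"
  shows "ereal (\<gamma>f - e) \<le> sup_inf_affine A B c0 c (observation lam f)"
    and "sup_inf_affine A B c0 c (observation lam f) \<le> ereal (\<gamma>f + e)"
proof -
  define L where "L a b = (\<Sum>k\<in>UNIV. c a b $ k * lam k f)" for a b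
  have le: "(\<Sum>i\<in>I a. \<sigma> a b i * gam i f) - L a b \<le> e' a b"
      "- (\<Sum>j\<in>J b. \<tau> a b j * gam j f) + L a b \<le> e'' a b"
      "e' a b + e'' a b \<le> 2 * e" "\<sigma> a b \<in> std_simplex (I a)" "\<tau> a b \<in> std_simplex (J b)"
    if "a \<in> A" "b \<in> B" for a b
    using feas that f unfolding program_feasible_def support_fun_def L_def
    by (auto simp: SUP_le_iff)
  have val: "sup_inf_affine A B c0 c (observation lam f) = (SUP a\<in>A. INF b\<in>B. ereal (c0 a b + L a b))"
    by (simp add: sup_inf_affine_def observation_def L_def)
  have lower: "\<exists>i\<in>I a. gam i f - e \<le> c0 a b + L a b" if ab: "a \<in> A" "b \<in> B" for a b
  proof -
    obtain i where "i \<in> I a" "gam i f \<le> (\<Sum>i\<in>I a. \<sigma> a b i * gam i f)"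
      using simplex_ge_some[OF fin(1)[OF ab(1)] le(4)[OF ab], of "\<lambda>i. gam i f"] by blast
    then show ?thesis using le(1,3)[OF ab] c0[OF ab] by (intro bexI[of _ i]) auto
  qed
  have upper: "\<exists>j\<in>J b. c0 a b + L a b \<le> gam j f + e" if ab: "a \<in> A" "b \<in> B" for a b
  proof -
    obtain j where "j \<in> J b" "- gam j f \<le> (\<Sum>j\<in>J b. \<tau> a b j * - gam j f)"
      using simplex_ge_some[OF fin(2)[OF ab(2)] le(5)[OF ab], of "\<lambda>j. - gam j f"] by blast
    then show ?thesis using le(2)[OF ab] c0[OF ab]
      by (intro bexI[of _ j]) (auto simp: sum_negf)
  qed
  have "ereal \<gamma>f \<le> (SUP a\<in>A. INF b\<in>B. ereal (c0 a b + L a b)) + ereal e"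
    unfolding \<gamma>1
  proof (rule SUP_least)
    fix a assume a: "a \<in> A"
    have "(INF i\<in>I a. ereal (gam i f)) - ereal e \<le> (INF b\<in>B. ereal (c0 a b + L a b))"
    proof (rule INF_greatest)
      fix b assume "b \<in> B"
      then obtain i where i: "i \<in> I a" "gam i f - e \<le> c0 a b + L a b" using lower a by blast
      have "(INF i\<in>I a. ereal (gam i f)) - ereal e \<le> ereal (gam i f) - ereal e"
        using i by (intro ereal_minus_mono INF_lower) auto
      also have "\<dots> \<le> ereal (c0 a b + L a b)" using i by simp
      finally show "(INF i\<in>I a. ereal (gam i f)) - ereal e \<le> ereal (c0 a b + L a b)" .
    qed
    also have "\<dots> \<le> (SUP a\<in>A. INF b\<in>B. ereal (c0 a b + L a b))" using a by (rule SUP_upper)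
    finally show "(INF i\<in>I a. ereal (gam i f)) \<le> (SUP a\<in>A. INF b\<in>B. ereal (c0 a b + L a b)) + ereal e"
      by (simp add: ereal_minus_le)
  qed
  then show "ereal (\<gamma>f - e) \<le> sup_inf_affine A B c0 c (observation lam f)"
    unfolding val by (cases "SUP a\<in>A. INF b\<in>B. ereal (c0 a b + L a b)") auto
  show "sup_inf_affine A B c0 c (observation lam f) \<le> ereal (\<gamma>f + e)"
    unfolding val
  proof (rule SUP_least)
    fix a assume a: "a \<in> A"
    have "(INF b\<in>B. ereal (c0 a b + L a b)) - ereal e \<le> ereal \<gamma>f"
      unfolding \<gamma>2
    proof (rule INF_greatest)
      fix b assume b: "b \<in> B"
      then obtain j where j: "j \<in> J b" "c0 a b + L a b \<le> gam j f + e" using upper a by blast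
      have "(INF b\<in>B. ereal (c0 a b + L a b)) \<le> ereal (c0 a b + L a b)" using b by (rule INF_lower)
      also have "\<dots> \<le> ereal (gam j f) + ereal e" using j by simp
      also have "\<dots> \<le> (SUP j\<in>J b. ereal (gam j f)) + ereal e"
        using j by (intro add_right_mono SUP_upper)
      finally show "(INF b\<in>B. ereal (c0 a b + L a b)) - ereal e \<le> (SUP j\<in>J b. ereal (gam j f))"
        by (simp add: ereal_minus_le)
    qed
    then show "(INF b\<in>B. ereal (c0 a b + L a b)) \<le> ereal (\<gamma>f + e)"
      by (simp add: ereal_minus_le)
  qed
qed

lemma error_lower_bound_feasible:
  fixes lam :: "'m::finite \<Rightarrow> 'f::real_vector \<Rightarrow> real"
  assumes lam: "\<And>k. linear (lam k)"
    and K: "convex K" "K \<noteq> {}"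
    and gam: "\<And>i. linear (gam i)"
    and fin: "\<And>a. a \<in> A \<Longrightarrow> finite (I a)" "\<And>b. b \<in> B \<Longrightarrow> finite (J b)"
    and \<gamma>1: "\<And>f. ereal (\<gamma> f) = (SUP a\<in>A. INF i\<in>I a. ereal (gam i f))"
    and \<gamma>2: "\<And>f. ereal (\<gamma> f) = (INF b\<in>B. SUP j\<in>J b. ereal (gam j f))"
    and E: "error_lower_bound K \<gamma> lam \<le> ereal E"
  shows "\<exists>e' e'' c \<sigma> \<tau>. program_feasible K lam gam A B I J E e' e'' c \<sigma> \<tau>"
proof -
  define P where "P a b s r d \<rho> \<theta> \<longleftrightarrow> \<rho> \<in> std_simplex (I a) \<and> \<theta> \<in> std_simplex (J b) \<and> s + r \<le> 2 * E \<and>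
      support_fun K (\<lambda>f. (\<Sum>i\<in>I a. \<rho> i * gam i f) - (\<Sum>k\<in>UNIV. d $ k * lam k f)) \<le> ereal s \<and>
      support_fun K (\<lambda>f. - (\<Sum>j\<in>J b. \<theta> j * gam j f) + (\<Sum>k\<in>UNIV. d $ k * lam k f)) \<le> ereal r"
    for a b s r and d :: "real ^ 'm" and \<rho> \<theta>
  have "\<exists>s r d \<rho> \<theta>. P a b s r d \<rho> \<theta>"
    if a: "a \<in> A" and b: "b \<in> B" for a b
  proof -
    have "\<exists>i\<in>I a. \<exists>j\<in>J b. gam i f - gam j g \<le> 2 * E"
      if fg: "f \<in> K" "g \<in> K" "observation lam f = observation lam g" for f g
    proof -
      have "ereal (\<bar>\<gamma> f - \<gamma> g\<bar> / 2) \<le> error_lower_bound K \<gamma> lam"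
        unfolding error_lower_bound_def using fg by (intro SUP_upper2[of "(f, g)"]) auto
      then have "ereal (\<bar>\<gamma> f - \<gamma> g\<bar> / 2) \<le> ereal E" using E by (rule order_trans)
      then have "\<gamma> f - \<gamma> g \<le> 2 * E" by simp
      moreover obtain i where "i \<in> I a" "gam i f \<le> \<gamma> f"
        using SUP_INF_ge_some[OF \<gamma>1 a fin(1)[OF a]] by blast
      moreover obtain j where "j \<in> J b" "\<gamma> g \<le> gam j g"
        using INF_SUP_le_some[OF \<gamma>2 b fin(2)[OF b]] by blast
      ultimately show ?thesis by (intro bexI[of _ i] bexI[of _ j]) auto
    qed
    then obtain \<rho> \<theta> and d :: "real ^ 'm" where 1: "\<rho> \<in> std_simplex (I a)" "\<theta> \<in> std_simplex (J b)"
      and 2: "\<And>f g. f \<in> K \<Longrightarrow> g \<in> K \<Longrightarrow>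
      ((\<Sum>i\<in>I a. \<rho> i * gam i f) - (\<Sum>k\<in>UNIV. d $ k * lam k f))
      + (- (\<Sum>j\<in>J b. \<theta> j * gam j g) + (\<Sum>k\<in>UNIV. d $ k * lam k g)) \<le> 2 * E"
      using simplex_multiplier_duality[of lam K gam "I a" "J b" "2 * E", OF lam K(1) gam fin(1)[OF a] fin(2)[OF b]
          SUP_INF_real_nonempty(2)[OF \<gamma>1 a] INF_SUP_real_nonempty(2)[OF \<gamma>2 b]] by blast
    obtain s where
      "support_fun K (\<lambda>f. (\<Sum>i\<in>I a. \<rho> i * gam i f) - (\<Sum>k\<in>UNIV. d $ k * lam k f)) \<le> ereal s"
      "support_fun K (\<lambda>f. - (\<Sum>j\<in>J b. \<theta> j * gam j f) + (\<Sum>k\<in>UNIV. d $ k * lam k f)) \<le> ereal (2 * E - s)"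
      by (rule split_sum_bound[OF K(2), of
          "\<lambda>f. (\<Sum>i\<in>I a. \<rho> i * gam i f) - (\<Sum>k\<in>UNIV. d $ k * lam k f)"
          "\<lambda>f. - (\<Sum>j\<in>J b. \<theta> j * gam j f) + (\<Sum>k\<in>UNIV. d $ k * lam k f)" "2 * E", OF 2])
    then have "P a b s (2 * E - s) d \<rho> \<theta>" using 1 by (simp add: P_def)
    then show ?thesis by blast
  qed
  then obtain e' e'' c \<sigma> \<tau> where
    "\<And>a b. a \<in> A \<Longrightarrow> b \<in> B \<Longrightarrow> P a b (e' a b) (e'' a b) (c a b) (\<sigma> a b) (\<tau> a b)"
    by metis
  then have "program_feasible K lam gam A B I J E e' e'' c \<sigma> \<tau>"
    by (simp add: program_feasible_def P_def)
  then show ?thesis by blast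
qed

theorem proposition6:
  fixes lam :: "'m::finite \<Rightarrow> 'f::real_vector \<Rightarrow> real"
    and K :: "'f set"
    and \<gamma> :: "'f \<Rightarrow> real"
    and gam :: "'i \<Rightarrow> 'f \<Rightarrow> real"
    and A :: "'a set" and B :: "'b set"
    and I :: "'a \<Rightarrow> 'i set" and J :: "'b \<Rightarrow> 'i set"
    and e :: real and e' e'' c0 :: "'a \<Rightarrow> 'b \<Rightarrow> real"
    and c :: "'a \<Rightarrow> 'b \<Rightarrow> real ^ 'm"
    and \<sigma> \<tau> :: "'a \<Rightarrow> 'b \<Rightarrow> 'i \<Rightarrow> real"
    and \<delta> :: "real ^ 'm \<Rightarrow> real"
  assumes "\<And>k. linear (lam k)"
    and "convex K" and "0 \<in> K"
    and "\<And>i. linear (gam i)"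
    and "\<And>a. a \<in> A \<Longrightarrow> finite (I a)"
    and "\<And>b. b \<in> B \<Longrightarrow> finite (J b)"
    and "\<And>f. ereal (\<gamma> f) = (SUP a\<in>A. INF i\<in>I a. ereal (gam i f))"
    and "\<And>f. ereal (\<gamma> f) = (INF b\<in>B. SUP j\<in>J b. ereal (gam j f))"
    and "program_minimizer K lam gam A B I J e e' e'' c \<sigma> \<tau>"
    and "\<And>a b. a \<in> A \<Longrightarrow> b \<in> B \<Longrightarrow> c0 a b = e - e'' a b"
    and "\<And>y. \<delta> y = real_of_ereal (sup_inf_affine A B c0 c y)"
  shows "(\<forall>f\<in>K. ereal (\<delta> (observation lam f)) = sup_inf_affine A B c0 c (observation lam f))
    \<and> (finite A \<and> finite B \<longrightarrow> (\<forall>y. ereal (\<delta> y) = sup_inf_affine A B c0 c y))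
    \<and> optimal_functional K \<gamma> lam \<delta>"
proof -
  have feas: "program_feasible K lam gam A B I J e e' e'' c \<sigma> \<tau>"
    and min: "\<And>x x' x'' d \<rho> \<theta>. program_feasible K lam gam A B I J x x' x'' d \<rho> \<theta> \<Longrightarrow> e \<le> x"
    using assms(9) unfolding program_minimizer_def by blast+
  have bounds: "ereal (\<gamma> f - e) \<le> sup_inf_affine A B c0 c (observation lam f)"
      "sup_inf_affine A B c0 c (observation lam f) \<le> ereal (\<gamma> f + e)" if "f \<in> K" for f
    using feasible_sup_inf_affine_bounds[of A I B J "\<gamma> f" gam f K lam e e' e'' c \<sigma> \<tau> c0]
      assms(5-8,10) feas that by blast+
  have real: "ereal (\<delta> (observation lam f)) = sup_inf_affine A B c0 c (observation lam f)"
    if "f \<in> K" for f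
    using bounds[OF that] unfolding assms(11)
    by (cases "sup_inf_affine A B c0 c (observation lam f)") auto
  have err: "\<bar>\<gamma> f - \<delta> (observation lam f)\<bar> \<le> e" if "f \<in> K" for f
    using bounds[OF that, folded real[OF that]] by auto
  have "worst_case_error K \<gamma> lam \<delta> \<le> ereal e"
    unfolding worst_case_error_def using err by (auto intro!: SUP_least)
  also have "ereal e \<le> error_lower_bound K \<gamma> lam"
  proof (cases "error_lower_bound K \<gamma> lam")
    case (real E)
    have ne: "K \<noteq> {}" using assms(3) by blast
    have le: "error_lower_bound K \<gamma> lam \<le> ereal E" using real by simp
    have "\<exists>x' x'' d \<rho> \<theta>. program_feasible K lam gam A B I J E x' x'' d \<rho> \<theta>"
      by (rule error_lower_bound_feasible[where \<gamma> = \<gamma>]) (fact assms ne le)+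
    then obtain x' x'' d \<rho> \<theta> where "program_feasible K lam gam A B I J E x' x'' d \<rho> \<theta>"
      by (elim exE)
    then have "e \<le> E" by (rule min)
    then show ?thesis using real by simp
  next
    case PInf
    then show ?thesis by simp
  next
    case MInf
    \<comment> \<open>Excluded, because the pair \<open>(0, 0)\<close> is admissible.\<close>
    have "ereal (\<bar>\<gamma> 0 - \<gamma> 0\<bar> / 2) \<le> error_lower_bound K \<gamma> lam"
      unfolding error_lower_bound_def using assms(3) by (intro SUP_upper2[of "(0, 0)"]) auto
    then show ?thesis using MInf by simp
  qed
  finally have "optimal_functional K \<gamma> lam \<delta>" by (simp add: optimal_functional_def)
  moreover have "ereal (\<delta> y) = sup_inf_affine A B c0 c y" if "finite A" "finite B" for y
  proof -
    have "\<bar>sup_inf_affine A B c0 c y\<bar> \<noteq> \<infinity>"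
      unfolding sup_inf_affine_def using that
        SUP_INF_real_nonempty(1)[OF assms(7)] INF_SUP_real_nonempty(1)[OF assms(8)]
      by (intro SUP_INF_finite_real)
    then show ?thesis unfolding assms(11) by (rule ereal_real')
  qed
  ultimately show ?thesis using real by blast
qed

end
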